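(* Let $a,b\ge2$ be integers. Rowmotion on the fence $\breve F(a,b)$ has the following properties. (a) All orbits $\mathcal O$ have size $\ell=\operatorname{lcm}(a,b)$ except for one, $\mathcal O'$, which is the orbit of the empty set and has size $\ell+1$. (b) The number of orbits is $\gcd(a,b)$. (c) For any orbit $\mathcal O$ of size $\ell$, $$\chi(\mathcal O)=\frac{2ab-a-b}{\gcd(a,b)}=:m,$$ and for the orbit of size $\ell+1$, $\chi(\mathcal O')=m+1$. (d) For any orbit $\mathcal O$ of size $\ell$, $$\hat\chi(\mathcal O)=\frac{\ell(a+b-2)}{2},$$ and for the orbit of size $\ell+1$, $$\hat\chi(\mathcal O')=\frac{(\ell+2)(a+b-2)}{2}+1.$$
   Context: The fence $\breve F(a,b)$ is the poset on $x_1,\dots,x_{a+b-1}$ with covering relations $x_1\lhd x_2\lhd\cdots\lhd x_a\rhd x_{a+1}\rhd\cdots\rhd x_{a+b-1}$. For a finite poset $P$, rowmotion on antichains is the bijection $\rho$ on the set of antichains sending $A$ to the set of minimal elements of $P\setminus I$, where $I$ is the (lower order) ideal generated by $A$. Rowmotion on ideals is the bijection $\hat\rho$ on the set of ideals sending $I$ to the ideal generated by the minimal elements of $P\setminus I$. Orbits are those of the cyclic groups generated by these maps; $A\mapsto$ (ideal generated by $A$) gives a size-preserving bijection between orbits of $\rho$ and of $\hat\rho$, and corresponding orbits are denoted by the same letter. For an orbit $\mathcal O$, $\chi(\mathcal O)=\sum_{A}\#A$ over the antichains $A$ in the orbit, and $\hat\chi(\mathcal O)=\sum_I\#I$ over the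 ideals $I$ in the orbit. *)

theory Defs
  imports Complex_Main "HOL-Algebra.Bij" "HOL-Algebra.Generated_Groups" "HOL-Algebra.Group_Action"
begin

text \<open>
  A poset is a relation \<open>r\<close> with \<open>Partial_order r\<close>; its elements are \<open>Field r\<close> and
  \<open>(x, y) \<in> r\<close> means \<open>x \<le> y\<close>. The lower order ideals are the library's \<open>ofilter\<close>s
  (subsets of \<open>Field r\<close> closed under going down, despite the name).
\<close>

definition order_ideals :: "'a rel \<Rightarrow> 'a set set" where
  "order_ideals r = {I. ofilter r I}"

definition antichains :: "'a rel \<Rightarrow> 'a set set" where
  "antichains r = {A. A \<subseteq> Field r \<and> (\<forall>x\<in>A. \<forall>y\<in>A. (x, y) \<in> r \<longrightarrow> x = y)}"

definition ideal_generated :: "'a rel \<Rightarrow> 'a set \<Rightarrow> 'a set" where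
  "ideal_generated r A = (\<Union>x\<in>A. under r x)"

definition minimal_elements :: "'a rel \<Rightarrow> 'a set \<Rightarrow> 'a set" where
  "minimal_elements r S = {x \<in> S. \<forall>y\<in>S. (y, x) \<in> r \<longrightarrow> y = x}"

definition antichain_rowmotion :: "'a rel \<Rightarrow> 'a set \<Rightarrow> 'a set" where
  "antichain_rowmotion r A = minimal_elements r (Field r - ideal_generated r A)"

definition ideal_rowmotion :: "'a rel \<Rightarrow> 'a set \<Rightarrow> 'a set" where
  "ideal_rowmotion r I = ideal_generated r (minimal_elements r (Field r - I))"

text \<open>
  The cyclic subgroup generated by a bijection \<open>f\<close> of \<open>X\<close> inside the group of all bijections
  of \<open>X\<close>. The elements of \<open>BijGroup X\<close> are extensional functions, hence the \<open>restrict\<close>.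
  The lemmas below show that rowmotion on a finite poset is indeed a bijection.
\<close>

definition cyclic_group_of :: "('x \<Rightarrow> 'x) \<Rightarrow> 'x set \<Rightarrow> ('x \<Rightarrow> 'x) monoid" where
  "cyclic_group_of f X = (BijGroup X)\<lparr>carrier := generate (BijGroup X) {restrict f X}\<rparr>"

definition antichain_orbit :: "'a rel \<Rightarrow> 'a set \<Rightarrow> 'a set set" where
  "antichain_orbit r A =
     Group_Action.orbit (cyclic_group_of (antichain_rowmotion r) (antichains r)) (\<lambda>g. g) A"

definition antichain_orbits :: "'a rel \<Rightarrow> 'a set set set" where
  "antichain_orbits r =
     Group_Action.orbits (cyclic_group_of (antichain_rowmotion r) (antichains r))
       (antichains r) (\<lambda>g. g)"

definition ideal_orbit :: "'a rel \<Rightarrow> 'a set \<Rightarrow> 'a set set" where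
  "ideal_orbit r I =
     Group_Action.orbit (cyclic_group_of (ideal_rowmotion r) (order_ideals r)) (\<lambda>g. g) I"

definition ideal_orbits :: "'a rel \<Rightarrow> 'a set set set" where
  "ideal_orbits r =
     Group_Action.orbits (cyclic_group_of (ideal_rowmotion r) (order_ideals r))
       (order_ideals r) (\<lambda>g. g)"

text \<open>
  Total size of the members of an orbit. On orbits of antichains this is the statistic
  \<open>\<chi>\<close>, on orbits of ideals it is its hatted version.
\<close>

definition total_size :: "'a set set \<Rightarrow> nat" where
  "total_size \<O> = (\<Sum>A\<in>\<O>. card A)"

text \<open>The element \<open>x\<^sub>i\<close> of the fence is represented by the number \<open>i\<close>.\<close>

definition fence_covers :: "nat \<Rightarrow> nat \<Rightarrow> nat rel" where
  "fence_covers a b =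
     {(i, i + 1) |i. 1 \<le> i \<and> i < a} \<union> {(i + 1, i) |i. a \<le> i \<and> i < a + b - 1}"

definition fence :: "nat \<Rightarrow> nat \<Rightarrow> nat rel" where
  "fence a b = Id_on {1..a + b - 1} \<union> (fence_covers a b)\<^sup>+"


subsection \<open>Well-definedness\<close>

lemma fence_covers_trancl:
  "(x, y) \<in> (fence_covers a b)\<^sup>+ \<longleftrightarrow>
     1 \<le> x \<and> x < y \<and> y \<le> a \<or> a \<le> y \<and> y < x \<and> x \<le> a + b - 1"
  (is "_ \<longleftrightarrow> ?R x y")
proof
  show "?R x y" if "(x, y) \<in> (fence_covers a b)\<^sup>+"
    using that by induction (auto simp: fence_covers_def)
  have up: "1 \<le> x \<Longrightarrow> x + Suc k \<le> a \<Longrightarrow> (x, x + Suc k) \<in> (fence_covers a b)\<^sup>+" for k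
  proof (induction k)
    case 0
    then show ?case by (auto simp: fence_covers_def)
  next
    case (Suc k)
    then have "(x + Suc k, x + Suc (Suc k)) \<in> fence_covers a b"
      by (auto simp: fence_covers_def)
    with Suc show ?case by (auto intro: trancl_into_trancl)
  qed
  have down: "a \<le> y \<Longrightarrow> y + Suc k \<le> a + b - 1 \<Longrightarrow> (y + Suc k, y) \<in> (fence_covers a b)\<^sup>+" for k
  proof (induction k)
    case 0
    then show ?case by (auto simp: fence_covers_def)
  next
    case (Suc k)
    then have "(y + Suc (Suc k), y + Suc k) \<in> fence_covers a b"
      by (auto simp: fence_covers_def)
    with Suc show ?case by (auto intro: trancl_into_trancl2)
  qed
  show "(x, y) \<in> (fence_covers a b)\<^sup>+" if "?R x y"
    using that up[of "y - x - 1"] down[of "x - y - 1"] by auto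
qed

lemma fence_iff:
  assumes "a \<ge> 1" "b \<ge> 1"
  shows "(x, y) \<in> fence a b \<longleftrightarrow> x = y \<and> 1 \<le> x \<and> x \<le> a + b - 1 \<or>
     1 \<le> x \<and> x < y \<and> y \<le> a \<or> a \<le> y \<and> y < x \<and> x \<le> a + b - 1"
  unfolding fence_def Un_iff fence_covers_trancl by auto

lemma Field_fence:
  assumes "a \<ge> 1" "b \<ge> 1"
  shows "Field (fence a b) = {1..a + b - 1}"
  using assms by (auto simp: Field_def Domain_iff Range_iff fence_iff)

lemma Partial_order_fence:
  assumes "a \<ge> 1" "b \<ge> 1"
  shows "Partial_order (fence a b)"
proof -
  have "Refl (fence a b)"
    using assms by (auto simp: refl_on_def Field_fence fence_iff)
  moreover have "trans (fence a b)"
    by (rule transI) (use assms in \<open>auto simp: fence_iff\<close>)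
  moreover have "antisym (fence a b)"
    by (rule antisymI) (use assms in \<open>auto simp: fence_iff\<close>)
  ultimately show ?thesis
    by (auto simp: partial_order_on_def preorder_on_def Field_def)
qed

context
  fixes r :: "'a rel"
  assumes po: "Partial_order r" and fin: "finite (Field r)"
begin

lemma ideal_generated_in_order_ideals: "ideal_generated r A \<in> order_ideals r"
proof -
  have "trans r" using po by (auto simp: partial_order_on_def preorder_on_def)
  then show ?thesis
    by (auto simp: order_ideals_def ofilter_def ideal_generated_def under_def
          intro: FieldI1 dest: transD)
qed

lemma minimal_elements_in_antichains:
  "S \<subseteq> Field r \<Longrightarrow> minimal_elements r S \<in> antichains r"
  by (auto simp: minimal_elements_def antichains_def)

lemma antichain_subset_ideal_generated: "A \<in> antichains r \<Longrightarrow> A \<subseteq> ideal_generated r A"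
  using po by (fastforce simp: antichains_def ideal_generated_def under_def
      partial_order_on_def preorder_on_def refl_on_def)

lemma inj_on_ideal_generated: "inj_on (ideal_generated r) (antichains r)"
proof -
  have "A \<subseteq> B"
    if A: "A \<in> antichains r" and B: "B \<in> antichains r"
      and eq: "ideal_generated r A = ideal_generated r B" for A B
  proof
    fix x assume x: "x \<in> A"
    then obtain y where y: "y \<in> B" "(x, y) \<in> r"
      using antichain_subset_ideal_generated[OF A] eq
      by (auto simp: ideal_generated_def under_def)
    then have "y \<in> ideal_generated r A"
      using antichain_subset_ideal_generated[OF B] eq by blast
    then obtain z where z: "z \<in> A" "(y, z) \<in> r"
      by (auto simp: ideal_generated_def under_def)
    have "trans r" and as: "antisym r"
      using po by (auto simp: partial_order_on_def preorder_on_def)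
    with y z have "(x, z) \<in> r" by (blast dest: transD)
    with x z A have "x = z" by (auto simp: antichains_def)
    with y z as show "x \<in> B" by (auto dest: antisymD)
  qed
  then show ?thesis by (intro inj_onI) blast
qed

lemma minimal_element_below:
  assumes "S \<subseteq> Field r" "x \<in> S"
  shows "\<exists>y \<in> minimal_elements r S. (y, x) \<in> r"
proof -
  have tr: "trans r" and as: "antisym r" and re: "Refl r"
    using po by (auto simp: partial_order_on_def preorder_on_def)
  have "finite S" using assms fin finite_subset by blast
  define T where "T = {y \<in> S. (y, x) \<in> r}"
  have finT: "finite T" using \<open>finite S\<close> by (auto simp: T_def)
  have "x \<in> T" using assms re by (auto simp: T_def refl_on_def)
  then obtain y where y: "y \<in> T" and least: "\<And>z. z \<in> T \<Longrightarrow> card (under r y) \<le> card (under r z)"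
    using arg_min_if_finite[OF finT, of "\<lambda>y. card (under r y)"]
      by (metis empty_iff leI)
  have "z = y" if z: "z \<in> S" "(z, y) \<in> r" for z
  proof (rule ccontr)
    assume "z \<noteq> y"
    have "z \<in> T" using z y tr by (auto simp: T_def dest: transD)
    have "under r z \<subseteq> under r y" using z tr by (auto simp: under_def dest: transD)
    moreover have "y \<in> under r y" using y assms re by (auto simp: T_def under_def refl_on_def)
    moreover have "y \<notin> under r z" using z \<open>z \<noteq> y\<close> as by (auto simp: under_def dest: antisymD)
    ultimately have "under r z \<subset> under r y" by blast
    moreover have "finite (under r y)" using fin under_Field finite_subset by metis
    ultimately have "card (under r z) < card (under r y)" by (rule psubset_card_mono[rotated])
    with least[OF \<open>z \<in> T\<close>] show False by simp
  qed
  with y show ?thesis by (auto simp: T_def minimal_elements_def)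
qed

lemma inj_on_minimal_elements:
  "inj_on (\<lambda>I. minimal_elements r (Field r - I)) (order_ideals r)"
proof -
  have "I \<subseteq> J"
    if I: "I \<in> order_ideals r" and J: "J \<in> order_ideals r"
      and eq: "minimal_elements r (Field r - I) = minimal_elements r (Field r - J)" for I J
  proof
    fix x assume x: "x \<in> I"
    show "x \<in> J"
    proof (rule ccontr)
      assume "x \<notin> J"
      then have "x \<in> Field r - J" using I x by (auto simp: order_ideals_def ofilter_def)
      then obtain y where "y \<in> minimal_elements r (Field r - J)" "(y, x) \<in> r"
        using minimal_element_below[of "Field r - J" x] by blast
      with eq have "y \<notin> I" "(y, x) \<in> r" by (auto simp: minimal_elements_def)
      with I x show False by (auto simp: order_ideals_def ofilter_def under_def)
    qed
  qed
  then show ?thesis by (intro inj_onI) blast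
qed

lemma bij_betw_antichain_rowmotion:
  "bij_betw (antichain_rowmotion r) (antichains r) (antichains r)"
proof -
  have "antichains r \<subseteq> Pow (Field r)" by (auto simp: antichains_def)
  then have "finite (antichains r)" using fin finite_subset by blast
  moreover have "inj_on (antichain_rowmotion r) (antichains r)"
    using comp_inj_on[OF inj_on_ideal_generated inj_on_subset[OF inj_on_minimal_elements]]
      ideal_generated_in_order_ideals
    by (auto simp: antichain_rowmotion_def[abs_def] comp_def)
  moreover have "antichain_rowmotion r ` antichains r \<subseteq> antichains r"
    by (auto simp: antichain_rowmotion_def intro!: minimal_elements_in_antichains)
  ultimately show ?thesis
    by (simp add: bij_betw_def endo_inj_surj)
qed

lemma bij_betw_ideal_rowmotion:
  "bij_betw (ideal_rowmotion r) (order_ideals r) (order_ideals r)"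
proof -
  have "order_ideals r \<subseteq> Pow (Field r)" by (auto simp: order_ideals_def ofilter_def)
  then have "finite (order_ideals r)" using fin finite_subset by blast
  moreover have "inj_on (ideal_rowmotion r) (order_ideals r)"
    using comp_inj_on[OF inj_on_minimal_elements inj_on_subset[OF inj_on_ideal_generated]]
      minimal_elements_in_antichains
    by (auto simp: ideal_rowmotion_def[abs_def] comp_def)
  moreover have "ideal_rowmotion r ` order_ideals r \<subseteq> order_ideals r"
    by (auto simp: ideal_rowmotion_def intro!: ideal_generated_in_order_ideals)
  ultimately show ?thesis
    by (simp add: bij_betw_def endo_inj_surj)
qed

end

lemma ideal_generated_antichain_rowmotion:
  "ideal_generated r (antichain_rowmotion r A) = ideal_rowmotion r (ideal_generated r A)"
  by (simp add: antichain_rowmotion_def ideal_rowmotion_def)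

end

theory Submission
  imports Defs "HOL-Number_Theory.Cong"
begin

text \<open>
  An ideal of the fence other than the whole poset is given by the number \<open>i < a\<close> of elements
  it takes from the left chain and the number \<open>j < b\<close> it takes from the right chain, and
  rowmotion increases both coordinates cyclically: \<open>(i, j) \<mapsto> (i + 1 mod a, j + 1 mod b)\<close>.
  The only exception is that the whole poset is inserted between \<open>(a - 1, b - 1)\<close> and
  \<open>(0, 0)\<close>. The orbits are therefore the \<open>gcd a b\<close> diagonals of the torus
  \<open>\<int>\<^sub>a \<times> \<int>\<^sub>b\<close>, one of them with an additional element. Both
  statistics are sums of a function of \<open>i\<close> and a function of \<open>j\<close>, and a diagonal visits
  each value of \<open>i\<close> exactly \<open>lcm a b / a\<close> times and each value of \<open>j\<close>
  exactly \<open>lcm a b / b\<close> times.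
\<close>

subsection \<open>Cyclic groups of bijections\<close>

lemma funpow_mem:
  assumes "f ` X \<subseteq> X" "x \<in> X"
  shows "(f ^^ n) x \<in> X"
  using assms by (induction n) auto

text \<open>The forward orbit of the preimage \<open>y\<close> is finite and \<open>f\<close> maps
  it injectively into itself, hence onto itself. So \<open>y\<close> is \<open>f\<close> of one of
  its own iterates, and therefore an iterate of \<open>x = f y\<close>.\<close>

lemma funpow_inv_into:
  assumes "finite X" "bij_betw f X X" "x \<in> X"
  shows "\<exists>n. inv_into X f x = (f ^^ n) x"
proof -
  define y where "y = inv_into X f x"
  have y: "y \<in> X" "f y = x"
    using assms by (auto simp: y_def bij_betw_def inv_into_into f_inv_into_f)
  define S where "S = range (\<lambda>n. (f ^^ n) y)"
  have "S \<subseteq> X"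
    using assms y by (auto simp: S_def bij_betw_def intro!: funpow_mem)
  moreover have "f ` S \<subseteq> S"
  proof (unfold S_def, clarify)
    fix n
    show "f ((f ^^ n) y) \<in> range (\<lambda>n. (f ^^ n) y)"
      by (rule range_eqI[of _ _ "Suc n"]) simp
  qed
  ultimately have "f ` S = S"
    using assms by (meson bij_betw_def endo_inj_surj finite_subset inj_on_subset)
  moreover have "y \<in> S"
    unfolding S_def by (rule range_eqI[of _ _ 0]) simp
  ultimately obtain n where "y = f ((f ^^ n) y)"
    unfolding S_def by (metis (no_types, lifting) imageE)
  then have "y = (f ^^ n) x"
    using y(2) by (metis funpow_swap1)
  then show ?thesis
    unfolding y_def by blast
qed

text \<open>Since \<open>X\<close> is finite, the inverse of \<open>f\<close> acts at each point as
  an iterate of \<open>f\<close>, so the group-theoretic orbit reduces to forward iterates.\<close>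

lemma orbit_cyclic_group_of:
  assumes "finite X" "bij_betw f X X" "x \<in> X"
  shows "Group_Action.orbit (cyclic_group_of f X) (\<lambda>g. g) x = range (\<lambda>n. (f ^^ n) x)"
proof -
  let ?G = "BijGroup X" and ?f = "restrict f X"
  interpret group ?G by (rule group_BijGroup)
  have f: "?f \<in> Bij X"
    using assms by (auto simp: Bij_def)
  have fX: "f ` X \<subseteq> X"
    using assms by (auto simp: bij_betw_def)
  have sub: "generate ?G {?f} \<subseteq> Bij X"
    using generate_incl[of "{?f}"] f by (simp add: BijGroup_def)
  have pow: "restrict (f ^^ n) X \<in> generate ?G {?f}" for n
  proof (induction n)
    case 0
    then show ?case
      using generate.one[of ?G "{?f}"] by (simp add: BijGroup_def restrict_def id_def)
  next
    case (Suc n)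
    have "?f \<otimes>\<^bsub>?G\<^esub> restrict (f ^^ n) X \<in> generate ?G {?f}"
      by (intro generate.eng generate.incl Suc) auto
    also have "?f \<otimes>\<^bsub>?G\<^esub> restrict (f ^^ n) X = restrict (f ^^ Suc n) X"
      using f sub Suc funpow_mem[OF fX]
      by (auto simp: BijGroup_def compose_def restrict_def fun_eq_iff)
    finally show ?case .
  qed
  \<comment> \<open>The exponent may depend on \<open>y\<close>, because
    \<open>funpow_inv_into\<close> supplies one for each point separately.\<close>
  have gen: "\<forall>y\<in>X. \<exists>n. h y = (f ^^ n) y" if "h \<in> generate ?G {?f}" for h
    using that
  proof induction
    case one
    have "\<one>\<^bsub>?G\<^esub> y = (f ^^ 0) y" if "y \<in> X" for y
      using that by (simp add: BijGroup_def)
    then show ?case by blast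
  next
    case (incl h)
    have "h y = (f ^^ 1) y" if "y \<in> X" for y
      using that incl by simp
    then show ?case by blast
  next
    case (inv h)
    have "(inv\<^bsub>?G\<^esub> h) y = inv_into X f y" if "y \<in> X" for y
    proof -
      have "inv_into X ?f y = inv_into X f y"
        unfolding inv_into_def by (metis restrict_apply')
      with that inv f show ?thesis
        by (simp add: inv_BijGroup)
    qed
    with funpow_inv_into[OF assms(1,2)] show ?case by auto
  next
    case (eng h1 h2)
    show ?case
    proof
      fix y assume y: "y \<in> X"
      with eng.IH(2) obtain n where n: "h2 y = (f ^^ n) y" by blast
      with y have "(f ^^ n) y \<in> X" by (intro funpow_mem[OF fX])
      with eng.IH(1) obtain k where "h1 ((f ^^ n) y) = (f ^^ k) ((f ^^ n) y)" by blast
      with n have "h1 (h2 y) = (f ^^ (k + n)) y"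
        by (simp add: funpow_add)
      with y eng.hyps sub show "\<exists>n. (h1 \<otimes>\<^bsub>?G\<^esub> h2) y = (f ^^ n) y"
        by (auto simp: BijGroup_def compose_def)
    qed
  qed
  have "{h x |h. h \<in> generate ?G {?f}} = range (\<lambda>n. (f ^^ n) x)"
  proof (intro equalityI subsetI)
    fix y assume "y \<in> {h x |h. h \<in> generate ?G {?f}}"
    then obtain h where "h \<in> generate ?G {?f}" "y = h x" by blast
    with gen[of h] \<open>x \<in> X\<close> show "y \<in> range (\<lambda>n. (f ^^ n) x)" by blast
  next
    fix y assume "y \<in> range (\<lambda>n. (f ^^ n) x)"
    then obtain n where "y = restrict (f ^^ n) X x"
      using \<open>x \<in> X\<close> by auto
    with pow show "y \<in> {h x |h. h \<in> generate ?G {?f}}" by blast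
  qed
  then show ?thesis
    by (simp add: Group_Action.orbit_def cyclic_group_of_def)
qed

text \<open>Orbits are computed below by exhibiting a trajectory \<open>q\<close> that closes up
  after \<open>N\<close> steps; any \<open>q i\<close> can serve as the starting point.\<close>

lemma orbit_of_periodic_sequence:
  fixes q :: "nat \<Rightarrow> 'a"
  assumes "finite X" "bij_betw f X X" "q i \<in> X"
    and step: "\<And>n. f (q n) = q (Suc n)"
    and period: "\<And>n. q (n + N) = q n" and "N > 0"
  shows "Group_Action.orbit (cyclic_group_of f X) (\<lambda>g. g) (q i) = q ` {..<N}"
proof -
  have iter: "(f ^^ n) (q i) = q (i + n)" for n
    by (induction n) (simp_all add: step)
  have periods: "q (n + k * N) = q n" for n k
  proof (induction k)
    case (Suc k)
    then show ?case
      using period[of "n + k * N"] by (simp add: algebra_simps)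
  qed simp
  have "q (i + n) \<in> q ` {..<N}" for n
    using periods[of "(i + n) mod N" "(i + n) div N"] \<open>N > 0\<close> by force
  moreover have "q n \<in> range (\<lambda>n. q (i + n))" for n
  proof (rule range_eqI)
    \<comment> \<open>Raising the index \<open>n\<close> by \<open>i\<close> periods brings it to at
      least \<open>i\<close>, so \<open>q n\<close> is reached from \<open>q i\<close> by forward
      steps.\<close>
    have "i \<le> n + i * N" using \<open>N > 0\<close> by (simp add: trans_le_add2)
    then show "q n = q (i + (n + i * N - i))"
      by (simp add: periods)
  qed
  ultimately show ?thesis
    unfolding orbit_cyclic_group_of[OF assms(1-3)] iter by blast
qed

lemma sum_mod_period:
  fixes u :: "nat \<Rightarrow> nat"
  assumes "a > 0"
  shows "(\<Sum>n<c * a. u ((k + n) mod a)) = c * (\<Sum>i<a. u i)"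
proof -
  \<comment> \<open>Moving the window by one drops the term at \<open>k\<close> and appends the term
    at \<open>k + a\<close>, which has the same residue.\<close>
  have shift: "(\<Sum>n<a. u ((k + n) mod a)) = (\<Sum>i<a. u i)" for k
  proof (induction k)
    case (Suc k)
    have "u (k mod a) + (\<Sum>n<a. u ((Suc k + n) mod a)) = (\<Sum>n<Suc a. u ((k + n) mod a))"
      by (simp add: sum.lessThan_Suc_shift del: sum.lessThan_Suc)
    also have "\<dots> = (\<Sum>n<a. u ((k + n) mod a)) + u (k mod a)"
      by simp
    finally show ?case using Suc by simp
  qed simp
  have "(\<Sum>n<c * a. u ((k + n) mod a)) =
      (\<Sum>d<c. \<Sum>n = d * a..<d * a + a. u ((k + n) mod a))"
    by (simp add: sum.nat_group)
  also have "\<dots> = (\<Sum>d<c. \<Sum>n<a. u ((k + n) mod a))"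
  proof (rule sum.cong[OF refl])
    fix d
    have "(\<Sum>n = d * a..<d * a + a. u ((k + n) mod a)) =
        (\<Sum>n = 0..<a. u ((k + (n + d * a)) mod a))"
      using sum.shift_bounds_nat_ivl[of "\<lambda>n. u ((k + n) mod a)" 0 "d * a" a]
      by (simp add: add.commute)
    also have "\<dots> = (\<Sum>n = 0..<a. u ((k + n) mod a))"
      by (intro sum.cong refl) (metis add.assoc mod_mult_self1)
    finally show "(\<Sum>n = d * a..<d * a + a. u ((k + n) mod a)) = (\<Sum>n<a. u ((k + n) mod a))"
      by (simp add: lessThan_atLeast0)
  qed
  finally show ?thesis by (simp add: shift)
qed

subsection \<open>The torus with an additional point\<close>

text \<open>Diagonal \<open>k\<close> starts at \<open>(k, 0)\<close>. For injectivity,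
  \<open>k\<close> is recovered modulo the gcd and then \<open>n\<close> modulo the lcm;
  surjectivity follows by counting, as gcd times lcm is \<open>a * b\<close>.\<close>

lemma bij_betw_diagonals:
  fixes a b :: nat
  assumes "a > 0" "b > 0"
  shows "bij_betw (\<lambda>(k, n). ((k + n) mod a, n mod b))
    ({..<gcd a b} \<times> {..<lcm a b}) ({..<a} \<times> {..<b})"
proof -
  let ?h = "\<lambda>(k, n). ((k + n) mod a, n mod b)"
  have "inj_on ?h ({..<gcd a b} \<times> {..<lcm a b})"
  proof (rule inj_onI, clarsimp)
    fix k n k' n'
    assume k: "k < gcd a b" "k' < gcd a b" and n: "n < lcm a b" "n' < lcm a b"
      and "(k + n) mod a = (k' + n') mod a" "n mod b = n' mod b"
    then have A: "[k + n = k' + n'] (mod a)" and B: "[n = n'] (mod b)"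
      by (auto simp: cong_def)
    have "[k + n = k' + n'] (mod gcd a b)" "[n = n'] (mod gcd a b)"
      using A B by (auto intro: cong_dvd_modulus_nat)
    then have "[k = k'] (mod gcd a b)"
      by (metis cong_add_lcancel_nat cong_add_rcancel_nat cong_sym cong_trans)
    then have "k = k'"
      using k by (rule cong_less_modulus_unique_nat)
    with A have "[n = n'] (mod a)" by (simp add: cong_add_lcancel_nat)
    then have "[n = n'] (mod lcm a b)" using B by (rule cong_cong_lcm_nat)
    then have "n = n'"
      using n by (rule cong_less_modulus_unique_nat)
    with \<open>k = k'\<close> show "k = k' \<and> n = n'" ..
  qed
  moreover have "?h ` ({..<gcd a b} \<times> {..<lcm a b}) \<subseteq> {..<a} \<times> {..<b}"
    using assms by auto
  moreover have "card ({..<gcd a b} \<times> {..<lcm a b}) = card ({..<a} \<times> {..<b})"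
    by (simp flip: prod_gcd_lcm_nat)
  ultimately show ?thesis
    unfolding bij_betw_def by (intro conjI card_subset_eq) (simp_all add: card_image)
qed

text \<open>Treats rowmotion on antichains and on ideals at once: \<open>E\<close> embeds the torus
  in \<open>X\<close>, and \<open>T\<close> is the point inserted after the corner
  \<open>(a - 1, b - 1)\<close>.\<close>

locale torus_with_top =
  fixes a b :: nat and f :: "'x \<Rightarrow> 'x" and X :: "'x set"
    and E :: "nat \<times> nat \<Rightarrow> 'x" and T :: 'x
  assumes pos: "a > 0" "b > 0"
    and X_eq: "X = insert T (E ` ({..<a} \<times> {..<b}))"
    and inj_E: "inj_on E ({..<a} \<times> {..<b})"
    and T_fresh: "T \<notin> E ` ({..<a} \<times> {..<b})"
    and bij_f: "bij_betw f X X"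
    and f_E: "\<And>i j. i < a \<Longrightarrow> j < b \<Longrightarrow>
      f (E (i, j)) = (if Suc i = a \<and> Suc j = b then T else E (Suc i mod a, Suc j mod b))"
    and f_T: "f T = E (0, 0)"
begin

section \<open>Diagonals, cycles and orbits\<close>

abbreviation "orb \<equiv> Group_Action.orbit (cyclic_group_of f X) (\<lambda>g. g)"

text \<open>The trajectory of \<open>(k, 0)\<close> under the pure torus shift, with the detour
  through \<open>T\<close> left out.\<close>

definition diag :: "nat \<Rightarrow> nat \<Rightarrow> 'x" where
  "diag k n = E ((k + n) mod a, n mod b)"

text \<open>Diagonal 0 receives \<open>T\<close> because it is the one that contains the corner
  \<open>(a - 1, b - 1)\<close>, at index \<open>lcm a b - 1\<close>.\<close>

definition cycle :: "nat \<Rightarrow> 'x set" where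
  "cycle k = diag k ` {..<lcm a b} \<union> (if k = 0 then {T} else {})"

lemma lcm_pos: "lcm a b > 0"
  using pos by (simp add: lcm_pos_nat)

lemma finite_X: "finite X"
  by (simp add: X_eq)

lemma diag_in_X: "diag k n \<in> X"
  using pos by (auto simp: diag_def X_eq)

lemma diag_neq_T: "diag k n \<noteq> T"
  using T_fresh pos by (auto simp: diag_def)

lemma diag_eq_iff:
  assumes "k < gcd a b" "n < lcm a b" "k' < gcd a b" "n' < lcm a b"
  shows "diag k n = diag k' n' \<longleftrightarrow> k = k' \<and> n = n'"
proof
  assume "diag k n = diag k' n'"
  then have "((k + n) mod a, n mod b) = ((k' + n') mod a, n' mod b)"
    unfolding diag_def using pos by (intro inj_onD[OF inj_E]) auto
  then have "(k, n) = (k', n')"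
    using assms inj_onD[OF bij_betw_imp_inj_on[OF bij_betw_diagonals[OF pos]],
        of "(k, n)" "(k', n')"] by simp
  then show "k = k' \<and> n = n'" by simp
qed simp

lemma diag_surj:
  assumes "x \<in> X"
  obtains "x = T" | k n where "k < gcd a b" "n < lcm a b" "x = diag k n"
proof (cases "x = T")
  case False
  then obtain p where p: "p \<in> {..<a} \<times> {..<b}" "x = E p"
    using assms X_eq by auto
  then have "p \<in> (\<lambda>(k, n). ((k + n) mod a, n mod b)) ` ({..<gcd a b} \<times> {..<lcm a b})"
    using bij_betw_imp_surj_on[OF bij_betw_diagonals[OF pos]] by metis
  then show thesis
    using that(2) p(2) by (auto simp: diag_def)
qed (use that in simp)

lemma diag_period: "diag k (n + lcm a b) = diag k n"
proof -
  obtain c where "lcm a b = a * c" using dvd_lcm1 by (rule dvdE)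
  then have "(k + (n + lcm a b)) mod a = (k + n) mod a"
    by (simp flip: add.assoc)
  moreover obtain d where "lcm a b = b * d" using dvd_lcm2 by (rule dvdE)
  then have "(n + lcm a b) mod b = n mod b"
    by simp
  ultimately show ?thesis by (simp add: diag_def)
qed

text \<open>Expressing the corner by divisibility lets gcd and lcm decide whether, and when, a
  diagonal meets it.\<close>

lemma f_diag:
  "f (diag k n) = (if a dvd Suc (k + n) \<and> b dvd Suc n then T else diag k (Suc n))"
proof -
  have *: "Suc (m mod c) = c \<longleftrightarrow> c dvd Suc m" if "c > 0" for m c :: nat
    using that mod_Suc[of m c] mod_less_divisor[of c m]
    by (auto simp: dvd_eq_mod_eq_0 split: if_splits)
  show ?thesis
    using pos by (simp add: diag_def f_E * mod_Suc_eq)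
qed

lemma orb_diag:
  assumes "0 < k" "k < gcd a b"
  shows "orb (diag k i) = cycle k"
proof -
  \<comment> \<open>Meeting the corner would make the gcd divide both \<open>k + Suc n\<close> and
    \<open>Suc n\<close>, hence \<open>k\<close>, which lies strictly between 0 and the gcd.\<close>
  have "\<not> (a dvd Suc (k + n) \<and> b dvd Suc n)" for n
  proof
    assume "a dvd Suc (k + n) \<and> b dvd Suc n"
    then have "gcd a b dvd k + Suc n" "gcd a b dvd Suc n"
      by (auto intro: dvd_trans)
    then have "gcd a b dvd k" using dvd_add_left_iff by blast
    with assms show False by (auto dest: dvd_imp_le)
  qed
  then have step: "f (diag k n) = diag k (Suc n)" for n
    by (auto simp: f_diag)
  have "orb (diag k i) = diag k ` {..<lcm a b}"
    by (rule orbit_of_periodic_sequence)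
      (simp_all add: finite_X bij_f diag_in_X step diag_period lcm_pos)
  then show ?thesis
    using assms by (simp add: cycle_def)
qed

lemma orb_of_cycle_0:
  assumes "x \<in> cycle 0"
  shows "orb x = cycle 0"
proof -
  let ?l = "lcm a b"
  \<comment> \<open>One period of length \<open>Suc ?l\<close>: the whole diagonal 0 in order, then
    \<open>T\<close> in the last slot.\<close>
  define q where "q n = (let r = n mod Suc ?l in if r = ?l then T else diag 0 r)" for n
  have step: "f (q n) = q (Suc n)" for n
  proof -
    define r where "r = n mod Suc ?l"
    have "r \<le> ?l" unfolding r_def by (metis less_Suc_eq_le mod_less_divisor zero_less_Suc)
    have Suc_r: "Suc n mod Suc ?l = (if r = ?l then 0 else Suc r)"
      by (simp add: r_def mod_Suc)
    consider "r = ?l" | "Suc r = ?l" | "Suc r < ?l"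
      using \<open>r \<le> ?l\<close> by linarith
    then show ?thesis
    proof cases
      case 1
      then show ?thesis
        using pos by (simp add: q_def Suc_r f_T diag_def lcm_eq_0_iff flip: r_def)
    next
      case 2
      then have "a dvd Suc r" "b dvd Suc r" by simp_all
      with 2 show ?thesis
        by (simp add: q_def Suc_r f_diag flip: r_def)
    next
      \<comment> \<open>A positive number below the lcm is no common multiple, so the corner is not
        met before the last index of the diagonal.\<close>
      case 3
      then have "\<not> (a dvd Suc r \<and> b dvd Suc r)"
        by (metis lcm_least dvd_imp_le not_less zero_less_Suc)
      with 3 show ?thesis
        by (auto simp add: q_def Suc_r f_diag simp flip: r_def)
    qed
  qed
  have "q ` {..<Suc ?l} = insert T (diag 0 ` {..<?l})"
    by (auto simp: q_def lessThan_Suc)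
  then have q_range: "q ` {..<Suc ?l} = cycle 0"
    by (simp add: cycle_def)
  then obtain i where i: "x = q i"
    using assms by blast
  have period: "q (n + Suc ?l) = q n" for n
    unfolding q_def by (simp only: mod_add_self2)
  have "q i \<in> X"
    using diag_in_X X_eq by (auto simp: q_def Let_def)
  then have "orb (q i) = q ` {..<Suc ?l}"
    by (rule orbit_of_periodic_sequence[OF finite_X bij_f _ step period zero_less_Suc])
  with q_range i show ?thesis by simp
qed

lemma orb_of_cycle:
  assumes "k < gcd a b" "x \<in> cycle k"
  shows "orb x = cycle k"
proof (cases "k = 0")
  case False
  with assms obtain n where "x = diag k n" by (auto simp: cycle_def)
  with assms False orb_diag show ?thesis by auto
qed (use assms orb_of_cycle_0 in simp)

lemma cycle_nonempty: "cycle k \<noteq> {}"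
  using lcm_pos by (auto simp: cycle_def)

lemma cycle_subset: "cycle k \<subseteq> X"
  using diag_in_X X_eq unfolding cycle_def by auto

lemma orbits_eq: "Group_Action.orbits (cyclic_group_of f X) X (\<lambda>g. g) = cycle ` {..<gcd a b}"
proof (intro equalityI subsetI)
  fix \<O> assume "\<O> \<in> Group_Action.orbits (cyclic_group_of f X) X (\<lambda>g. g)"
  then obtain x where x: "x \<in> X" "\<O> = orb x"
    unfolding Group_Action.orbits_def by blast
  have "\<exists>k\<in>{..<gcd a b}. x \<in> cycle k"
    using x(1)
  proof (cases rule: diag_surj)
    case 1
    then have "x \<in> cycle 0" by (simp add: cycle_def)
    then show ?thesis using pos by auto
  next
    case (2 k n)
    then have "x \<in> cycle k" by (simp add: cycle_def)
    with 2 show ?thesis by auto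
  qed
  then obtain k where k: "k \<in> {..<gcd a b}" "x \<in> cycle k" by blast
  then have "\<O> = cycle k"
    using x(2) orb_of_cycle[of k x] by simp
  then show "\<O> \<in> cycle ` {..<gcd a b}"
    using k(1) by (rule image_eqI)
next
  fix \<O> assume "\<O> \<in> cycle ` {..<gcd a b}"
  then obtain k where k: "k < gcd a b" "\<O> = cycle k" by auto
  obtain x where x: "x \<in> cycle k" using cycle_nonempty by blast
  then have "\<O> = orb x"
    using k orb_of_cycle[of k x] by simp
  with x cycle_subset show "\<O> \<in> Group_Action.orbits (cyclic_group_of f X) X (\<lambda>g. g)"
    unfolding Group_Action.orbits_def by blast
qed

lemma inj_on_cycle: "inj_on cycle {..<gcd a b}"
proof (rule inj_onI)
  fix k k' assume k: "k \<in> {..<gcd a b}" "k' \<in> {..<gcd a b}" "cycle k = cycle k'"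
  have "diag k 0 \<in> cycle k" using lcm_pos by (auto simp: cycle_def)
  with k(3) have "diag k 0 \<in> cycle k'" by simp
  then obtain n where "n < lcm a b" "diag k 0 = diag k' n"
    using diag_neq_T by (auto simp: cycle_def split: if_splits)
  with k lcm_pos show "k = k'" by (simp add: diag_eq_iff)
qed

lemma card_orbits: "card (Group_Action.orbits (cyclic_group_of f X) X (\<lambda>g. g)) = gcd a b"
  by (simp add: orbits_eq card_image inj_on_cycle)

text \<open>In both instances below, \<open>E (0, 0)\<close> is the empty set; this identifies its
  orbit as the exceptional one.\<close>

lemma orb_origin: "orb (E (0, 0)) = cycle 0"
proof (rule orb_of_cycle_0)
  have "E (0, 0) = diag 0 0" by (simp add: diag_def)
  then show "E (0, 0) \<in> cycle 0" using lcm_pos by (auto simp: cycle_def)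
qed

section \<open>Sums over a cycle\<close>

lemma sum_cycle:
  fixes w :: "'x \<Rightarrow> nat"
  assumes "k < gcd a b"
  shows "sum w (cycle k) = (\<Sum>n<lcm a b. w (diag k n)) + (if k = 0 then w T else 0)"
proof -
  have "sum w (diag k ` {..<lcm a b}) = (\<Sum>n<lcm a b. w (diag k n))"
    using assms by (subst sum.reindex) (auto simp: inj_on_def diag_eq_iff)
  moreover have "T \<notin> diag k ` {..<lcm a b}"
    using diag_neq_T by (metis imageE)
  ultimately show ?thesis
    by (cases "k = 0") (simp_all add: cycle_def)
qed

lemma card_cycle:
  assumes "k < gcd a b"
  shows "card (cycle k) = lcm a b + (if k = 0 then 1 else 0)"
proof -
  have "card (cycle k) = sum (\<lambda>_. 1) (cycle k)" by simp
  also have "\<dots> = lcm a b + (if k = 0 then 1 else 0)"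
    unfolding sum_cycle[OF assms] by simp
  finally show ?thesis .
qed

text \<open>Each coordinate runs through full periods, so its starting value does not matter: the
  result depends on \<open>k\<close> only through the term for \<open>T\<close>.\<close>

lemma sum_cycle_additive:
  fixes w :: "'x \<Rightarrow> nat"
  assumes "k < gcd a b" and w: "\<And>i j. i < a \<Longrightarrow> j < b \<Longrightarrow> w (E (i, j)) = u i + v j"
  shows "sum w (cycle k) = lcm a b div a * (\<Sum>i<a. u i) + lcm a b div b * (\<Sum>j<b. v j) +
    (if k = 0 then w T else 0)"
proof -
  have "(\<Sum>n<lcm a b. w (diag k n)) =
      (\<Sum>n<lcm a b. u ((k + n) mod a)) + (\<Sum>n<lcm a b. v ((0 + n) mod b))"
    unfolding diag_def using pos by (simp only: w mod_less_divisor sum.distrib add_0)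
  also have "(\<Sum>n<lcm a b. u ((k + n) mod a)) = lcm a b div a * (\<Sum>i<a. u i)"
    using sum_mod_period[OF pos(1), of u k "lcm a b div a"] by simp
  also have "(\<Sum>n<lcm a b. v ((0 + n) mod b)) = lcm a b div b * (\<Sum>j<b. v j)"
    using sum_mod_period[OF pos(2), of v 0 "lcm a b div b"] by simp
  finally show ?thesis
    using sum_cycle[OF assms(1)] by simp
qed

end

subsection \<open>Rowmotion on fences\<close>

text \<open>
  The pair \<open>(i, j)\<close> stands for the ideal with \<open>i < a\<close> elements of the chain
  \<open>x\<^sub>1 < \<dots> < x\<^sub>a\<close> and \<open>j < b\<close> elements of the chain
  \<open>x\<^sub>a\<^sub>+\<^sub>b\<^sub>-\<^sub>1 < \<dots> < x\<^sub>a\<close>, and for the antichain generating it.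
\<close>

definition fence_ideal :: "nat \<Rightarrow> nat \<Rightarrow> nat \<times> nat \<Rightarrow> nat set" where
  "fence_ideal a b = (\<lambda>(i, j). {x. 1 \<le> x \<and> x \<le> i \<or> a + b \<le> x + j \<and> x < a + b})"

definition fence_antichain :: "nat \<Rightarrow> nat \<Rightarrow> nat \<times> nat \<Rightarrow> nat set" where
  "fence_antichain a b = (\<lambda>(i, j). {x. 0 < i \<and> x = i \<or> 0 < j \<and> x + j = a + b})"

lemma mem_fence_ideal:
  "x \<in> fence_ideal a b (i, j) \<longleftrightarrow> 1 \<le> x \<and> x \<le> i \<or> a + b \<le> x + j \<and> x < a + b"
  by (simp add: fence_ideal_def)

lemma mem_fence_antichain:
  "x \<in> fence_antichain a b (i, j) \<longleftrightarrow> 0 < i \<and> x = i \<or> 0 < j \<and> x + j = a + b"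
  by (simp add: fence_antichain_def)

context
  fixes a b :: nat
  assumes pos: "a > 0" "b > 0"
begin

text \<open>Restates the order without the truncated subtraction in
  \<open>a + b - 1\<close>.\<close>

lemma le_fence_iff:
  "(x, y) \<in> fence a b \<longleftrightarrow> x = y \<and> 1 \<le> x \<and> x < a + b \<or>
     1 \<le> x \<and> x < y \<and> y \<le> a \<or> a \<le> y \<and> y < x \<and> x < a + b"
proof -
  have "z \<le> a + b - 1 \<longleftrightarrow> z < a + b" for z
    using pos by auto
  then show ?thesis
    using pos by (simp add: fence_iff)
qed

lemma Field_fence_eq: "Field (fence a b) = {1..<a + b}"
  using pos by (subst Field_fence) auto

lemma partial_order_fence: "Partial_order (fence a b)"
  using pos by (intro Partial_order_fence) auto

lemma finite_Field_fence: "finite (Field (fence a b))"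
  by (simp add: Field_fence_eq)

text \<open>The generators lie on different chains strictly below the top, so each generates just an
  initial segment of its own chain.\<close>

lemma ideal_generated_fence_antichain:
  assumes "i < a" "j < b"
  shows "ideal_generated (fence a b) (fence_antichain a b (i, j)) = fence_ideal a b (i, j)"
proof (rule Set.set_eqI)
  fix x
  \<comment> \<open>\<open>r\<close> is the position of the right generator. For
    \<open>j = 0\<close> it is \<open>a + b\<close>, just outside the fence, hence the guard
    \<open>0 < j\<close> below.\<close>
  obtain r where r: "a + b = r + j" "a < r"
    using assms that[of "a + b - j"] by simp
  have mem: "y \<in> fence_antichain a b (i, j) \<longleftrightarrow> 0 < i \<and> y = i \<or> 0 < j \<and> y = r" for y
    using r(1) by (auto simp: mem_fence_antichain)
  have "x \<in> ideal_generated (fence a b) (fence_antichain a b (i, j)) \<longleftrightarrow>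
      0 < i \<and> (x, i) \<in> fence a b \<or> 0 < j \<and> (x, r) \<in> fence a b"
    unfolding ideal_generated_def under_def UN_iff mem_Collect_eq Bex_def mem by blast
  moreover have "0 < i \<and> (x, i) \<in> fence a b \<longleftrightarrow> 1 \<le> x \<and> x \<le> i"
    using assms by (auto simp: le_fence_iff)
  moreover have "0 < j \<and> (x, r) \<in> fence a b \<longleftrightarrow> a + b \<le> x + j \<and> x < a + b"
    using r by (auto simp: le_fence_iff)
  ultimately show "x \<in> ideal_generated (fence a b) (fence_antichain a b (i, j)) \<longleftrightarrow> x \<in> fence_ideal a b (i, j)"
    by (simp only: mem_fence_ideal)
qed

lemma ideal_generated_top: "ideal_generated (fence a b) {a} = Field (fence a b)"
proof (rule Set.set_eqI)
  show "x \<in> ideal_generated (fence a b) {a} \<longleftrightarrow> x \<in> Field (fence a b)" for x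
    using pos by (auto simp: ideal_generated_def under_def le_fence_iff Field_fence_eq)
qed

text \<open>The complement is an interval of indices around the top \<open>a\<close>, and only its
  ends \<open>Suc i\<close> and \<open>a + b - Suc j\<close> can be minimal. An end equal to
  \<open>a\<close> lies above the other end, so it is minimal only when both ends are
  \<open>a\<close>.\<close>

lemma mem_minimal_elements_compl:
  assumes "i < a" "j < b"
  shows "x \<in> minimal_elements (fence a b) (Field (fence a b) - fence_ideal a b (i, j)) \<longleftrightarrow>
    x = Suc i \<and> x < a \<or> x + Suc j = a + b \<and> a < x \<or> x = a \<and> Suc i = a \<and> Suc j = b"
  (is "_ \<longleftrightarrow> ?R")
proof -
  have mem: "y \<in> Field (fence a b) - fence_ideal a b (i, j) \<longleftrightarrow> i < y \<and> y + j < a + b" for y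
    unfolding Diff_iff Field_fence_eq mem_fence_ideal atLeastLessThan_iff by auto
  obtain r where r: "a + b = r + Suc j" "a \<le> r"
    using assms that[of "a + b - Suc j"] by simp
  show ?thesis
  proof
    assume "x \<in> minimal_elements (fence a b) (Field (fence a b) - fence_ideal a b (i, j))"
    then have x: "i < x" "x + j < a + b"
      and least: "\<And>y. i < y \<Longrightarrow> y + j < a + b \<Longrightarrow> (y, x) \<in> fence a b \<Longrightarrow> y = x"
      unfolding minimal_elements_def mem_Collect_eq Ball_def mem by blast+
    have left: "x = Suc i" if "x \<le> a"
    proof (rule least[symmetric])
      show "(Suc i, x) \<in> fence a b" using x that assms by (auto simp: le_fence_iff)
    qed (use assms in auto)
    have right: "x = r" if "a \<le> x"
    proof (rule least[symmetric])
      show "(r, x) \<in> fence a b" using x that r by (auto simp: le_fence_iff)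
    qed (use assms r in auto)
    show ?R
      using left right r by (cases x a rule: linorder_cases) auto
  next
    assume R: ?R
    then have "i < x \<and> x + j < a + b"
      using assms by auto
    moreover have "y = x" if y: "i < y" "y + j < a + b" "(y, x) \<in> fence a b" for y
      using R y unfolding le_fence_iff by (elim disjE conjE) simp_all
    ultimately show "x \<in> minimal_elements (fence a b) (Field (fence a b) - fence_ideal a b (i, j))"
      unfolding minimal_elements_def mem_Collect_eq Ball_def mem by blast
  qed
qed

text \<open>When just one end reaches \<open>a\<close>, its chain contributes no minimal element,
  which is what wrapping that coordinate to 0 encodes; when both do, the result is
  \<open>{a}\<close>.\<close>

lemma minimal_elements_compl_fence_ideal:
  assumes "i < a" "j < b"
  shows "minimal_elements (fence a b) (Field (fence a b) - fence_ideal a b (i, j)) =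
    (if Suc i = a \<and> Suc j = b then {a} else fence_antichain a b (Suc i mod a, Suc j mod b))"
proof -
  have mods: "Suc i mod a = (if Suc i = a then 0 else Suc i)"
    "Suc j mod b = (if Suc j = b then 0 else Suc j)"
    using assms by auto
  show ?thesis
  proof (rule Set.set_eqI)
    fix x
    show "x \<in> minimal_elements (fence a b) (Field (fence a b) - fence_ideal a b (i, j)) \<longleftrightarrow>
      x \<in> (if Suc i = a \<and> Suc j = b then {a} else fence_antichain a b (Suc i mod a, Suc j mod b))"
      unfolding mem_minimal_elements_compl[OF assms] mods
      using assms by (cases "Suc i = a"; cases "Suc j = b"; auto simp: mem_fence_antichain)
  qed
qed

lemma fence_antichain_in_antichains:
  assumes "i < a" "j < b"
  shows "fence_antichain a b (i, j) \<in> antichains (fence a b)"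
proof -
  have "1 \<le> x \<and> x < a + b" if "x \<in> fence_antichain a b (i, j)" for x
    using that assms unfolding mem_fence_antichain by auto
  moreover have "x = y"
    if "x \<in> fence_antichain a b (i, j)" "y \<in> fence_antichain a b (i, j)" "(x, y) \<in> fence a b" for x y
    using that assms unfolding mem_fence_antichain le_fence_iff by (elim disjE conjE) simp_all
  ultimately show ?thesis
    unfolding antichains_def Field_fence_eq by auto
qed

text \<open>The top \<open>a\<close> is comparable to everything, so an antichain containing it is
  \<open>{a}\<close>. Any other antichain has at most one element on each side of \<open>a\<close>;
  coordinate 0 records that there is none.\<close>

lemma antichains_fence:
  "antichains (fence a b) = insert {a} (fence_antichain a b ` ({..<a} \<times> {..<b}))"
proof (intro equalityI subsetI)
  fix A assume "A \<in> antichains (fence a b)"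
  then have A: "1 \<le> x \<and> x < a + b" if "x \<in> A" for x
    using that unfolding antichains_def Field_fence_eq by auto
  have anti: "x = y" if "x \<in> A" "y \<in> A" "(x, y) \<in> fence a b" for x y
    using that \<open>A \<in> antichains (fence a b)\<close> unfolding antichains_def by blast
  show "A \<in> insert {a} (fence_antichain a b ` ({..<a} \<times> {..<b}))"
  proof (cases "a \<in> A")
    case True
    have "(x, a) \<in> fence a b" if "x \<in> A" for x
      using A[OF that] unfolding le_fence_iff by auto
    with anti True have "A = {a}" by blast
    then show ?thesis by simp
  next
    case False
    have "\<exists>i<a. \<forall>x. x \<in> A \<and> x < a \<longleftrightarrow> 0 < i \<and> x = i"
    proof (cases "\<exists>i\<in>A. i < a")
      case True
      then obtain i where i: "i \<in> A" "i < a" by blast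
      have "y = i" if "y \<in> A" "y < a" for y
        using i(2) that(2) A[OF i(1)] A[OF that(1)] anti[OF that(1) i(1)] anti[OF i(1) that(1)]
        unfolding le_fence_iff by (cases y i rule: linorder_cases) simp_all
      then have "y \<in> A \<and> y < a \<longleftrightarrow> y = i" for y using i by blast
      moreover have "0 < i" using A[OF i(1)] by simp
      ultimately show ?thesis using i(2) by blast
    next
      case False
      with pos show ?thesis by blast
    qed
    then obtain i where i: "i < a" "\<And>x. x \<in> A \<and> x < a \<longleftrightarrow> 0 < i \<and> x = i" by blast
    have "\<exists>j<b. \<forall>x. x \<in> A \<and> a < x \<longleftrightarrow> 0 < j \<and> x + j = a + b"
    proof (cases "\<exists>z\<in>A. a < z")
      case True
      then obtain z where z: "z \<in> A" "a < z" by blast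
      have "y = z" if "y \<in> A" "a < y" for y
        using z(2) that(2) A[OF z(1)] A[OF that(1)] anti[OF that(1) z(1)] anti[OF z(1) that(1)]
        unfolding le_fence_iff by (cases y z rule: linorder_cases) simp_all
      then have "y \<in> A \<and> a < y \<longleftrightarrow> y = z" for y using z by blast
      \<comment> \<open>\<open>j\<close> counts the elements of the right chain from its bottom
        \<open>a + b - 1\<close> up to \<open>z\<close>; \<open>a < z\<close> then yields
        \<open>j < b\<close>.\<close>
      moreover obtain j where j: "z + j = a + b" "0 < j"
        using A[OF z(1)] less_imp_add_positive by blast
      then have "y = z \<longleftrightarrow> 0 < j \<and> y + j = a + b" for y by auto
      moreover have "j < b" using j z(2) by linarith
      ultimately show ?thesis by blast
    next
      case False
      with pos show ?thesis by blast
    qed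
    then obtain j where j: "j < b" "\<And>x. x \<in> A \<and> a < x \<longleftrightarrow> 0 < j \<and> x + j = a + b" by blast
    have "x \<in> A \<longleftrightarrow> x \<in> fence_antichain a b (i, j)" for x
      unfolding mem_fence_antichain i(2)[symmetric] j(2)[symmetric]
      using False by (metis linorder_neqE_nat)
    then have "A = fence_antichain a b (i, j)" by blast
    with i(1) j(1) show ?thesis by blast
  qed
next
  fix A assume "A \<in> insert {a} (fence_antichain a b ` ({..<a} \<times> {..<b}))"
  moreover have "{a} \<in> antichains (fence a b)"
    using pos by (simp add: antichains_def Field_fence_eq)
  ultimately show "A \<in> antichains (fence a b)"
    using fence_antichain_in_antichains by auto
qed

section \<open>Cardinalities and injectivity in coordinates\<close>

lemma card_fence_antichain:
  assumes "i < a" "j < b"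
  shows "card (fence_antichain a b (i, j)) = of_bool (i > 0) + of_bool (j > 0)"
proof -
  obtain r where r: "a + b = r + j" "a < r"
    using assms that[of "a + b - j"] by simp
  then have "fence_antichain a b (i, j) = (if i = 0 then {} else {i}) \<union> (if j = 0 then {} else {r})"
    by (auto simp: fence_antichain_def)
  with r(2) assms show ?thesis by simp
qed

lemma card_fence_ideal:
  assumes "i < a" "j < b"
  shows "card (fence_ideal a b (i, j)) = i + j"
proof -
  have "fence_ideal a b (i, j) = {1..i} \<union> {a + b - j..<a + b}"
    using assms unfolding fence_ideal_def by (auto simp: le_diff_conv)
  moreover have "{1..i} \<inter> {a + b - j..<a + b} = {}"
    using assms by (auto simp: disjoint_iff)
  ultimately show ?thesis
    using assms by (simp add: card_Un_disjoint)
qed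

lemma inj_on_fence_antichain: "inj_on (fence_antichain a b) ({..<a} \<times> {..<b})"
proof (rule inj_onI, clarify)
  \<comment> \<open>Only positive coordinates are visible as elements. Applying this claim in both
    directions also settles the zero coordinates.\<close>
  have *: "(0 < i \<longrightarrow> i' = i) \<and> (0 < j \<longrightarrow> j' = j)"
    if lt: "i < a" "j < b" "i' < a" "j' < b"
      and eq: "fence_antichain a b (i, j) = fence_antichain a b (i', j')" for i j i' j'
  proof (intro conjI impI)
    assume "0 < i"
    then have "i \<in> fence_antichain a b (i', j')"
      unfolding eq[symmetric] mem_fence_antichain by simp
    then show "i' = i"
      unfolding mem_fence_antichain using lt by auto
  next
    assume "0 < j"
    obtain r where r: "a + b = r + j" "a < r"
      using lt that[of "a + b - j"] by simp
    then have "r \<in> fence_antichain a b (i', j')"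
      unfolding eq[symmetric] mem_fence_antichain using \<open>0 < j\<close> by simp
    then show "j' = j"
      unfolding mem_fence_antichain using lt r by auto
  qed
  fix i j i' j'
  assume lt: "i < a" "j < b" "i' < a" "j' < b"
    and eq: "fence_antichain a b (i, j) = fence_antichain a b (i', j')"
  from *[OF lt eq] *[OF lt(3,4,1,2) eq[symmetric]] show "i = i' \<and> j = j'"
    by auto
qed

section \<open>Rowmotion as a torus with an additional point\<close>

lemma antichain_torus:
  "torus_with_top a b (antichain_rowmotion (fence a b)) (antichains (fence a b)) (fence_antichain a b) {a}"
proof (rule torus_with_top.intro)
  show "{a} \<notin> fence_antichain a b ` ({..<a} \<times> {..<b})"
  proof clarify
    fix i j assume "i < a" "j < b" "{a} = fence_antichain a b (i, j)"
    then have "a \<in> fence_antichain a b (i, j)" by blast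
    then show False
      unfolding mem_fence_antichain using \<open>i < a\<close> \<open>j < b\<close> by simp
  qed
  show "bij_betw (antichain_rowmotion (fence a b)) (antichains (fence a b)) (antichains (fence a b))"
    by (rule bij_betw_antichain_rowmotion[OF partial_order_fence finite_Field_fence])
  \<comment> \<open>\<open>{a}\<close> generates the whole fence, whose complement has no minimal
    elements, so the image is the empty antichain.\<close>
  show "antichain_rowmotion (fence a b) {a} = fence_antichain a b (0, 0)"
    by (simp add: antichain_rowmotion_def ideal_generated_top minimal_elements_def
        fence_antichain_def)
  show "antichain_rowmotion (fence a b) (fence_antichain a b (i, j)) =
      (if Suc i = a \<and> Suc j = b then {a} else fence_antichain a b (Suc i mod a, Suc j mod b))"
    if "i < a" "j < b" for i j
    unfolding antichain_rowmotion_def ideal_generated_fence_antichain[OF that]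
    by (rule minimal_elements_compl_fence_ideal[OF that])
  show "antichains (fence a b) = insert {a} (fence_antichain a b ` ({..<a} \<times> {..<b}))"
    by (rule antichains_fence)
  show "inj_on (fence_antichain a b) ({..<a} \<times> {..<b})"
    by (rule inj_on_fence_antichain)
  show "a > 0" "b > 0"
    by (rule pos)+
qed

text \<open>Ideal rowmotion is surjective, and each of its values is by definition generated by a
  set of minimal elements, which is an antichain.\<close>

lemma order_ideals_eq_image: "order_ideals (fence a b) = ideal_generated (fence a b) ` antichains (fence a b)"
proof (intro Set.equalityI Set.subsetI)
  fix I assume "I \<in> order_ideals (fence a b)"
  then have "I \<in> ideal_rowmotion (fence a b) ` order_ideals (fence a b)"
    using bij_betw_ideal_rowmotion[OF partial_order_fence finite_Field_fence] by (simp add: bij_betw_def)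
  then obtain J where "I = ideal_rowmotion (fence a b) J"
    by (rule imageE)
  then show "I \<in> ideal_generated (fence a b) ` antichains (fence a b)"
    unfolding ideal_rowmotion_def
    using minimal_elements_in_antichains[OF partial_order_fence finite_Field_fence, of "Field (fence a b) - J"] by blast
next
  fix I assume "I \<in> ideal_generated (fence a b) ` antichains (fence a b)"
  then show "I \<in> order_ideals (fence a b)"
    using ideal_generated_in_order_ideals[OF partial_order_fence finite_Field_fence] by blast
qed

text \<open>The torus structure is transported from antichains along \<open>ideal_generated\<close>,
  which is injective on antichains and intertwines the two rowmotions.\<close>

lemma ideal_torus:
  "torus_with_top a b (ideal_rowmotion (fence a b)) (order_ideals (fence a b))
     (\<lambda>p. ideal_generated (fence a b) (fence_antichain a b p)) (Field (fence a b))"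
proof -
  interpret A: torus_with_top a b "antichain_rowmotion (fence a b)" "antichains (fence a b)" "fence_antichain a b" "{a}"
    by (rule antichain_torus)
  note inj = inj_on_ideal_generated[OF partial_order_fence finite_Field_fence]
  show ?thesis
  proof
    show "order_ideals (fence a b) = insert (Field (fence a b))
        ((\<lambda>p. ideal_generated (fence a b) (fence_antichain a b p)) ` ({..<a} \<times> {..<b}))"
      by (simp add: order_ideals_eq_image A.X_eq image_image ideal_generated_top)
    show "inj_on (\<lambda>p. ideal_generated (fence a b) (fence_antichain a b p)) ({..<a} \<times> {..<b})"
      using comp_inj_on[OF A.inj_E inj_on_subset[OF inj]] A.X_eq by (auto simp: comp_def)
    show "Field (fence a b) \<notin> (\<lambda>p. ideal_generated (fence a b) (fence_antichain a b p)) ` ({..<a} \<times> {..<b})"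
    proof
      assume "Field (fence a b) \<in> (\<lambda>p. ideal_generated (fence a b) (fence_antichain a b p)) ` ({..<a} \<times> {..<b})"
      then obtain p where p: "p \<in> {..<a} \<times> {..<b}"
        and eq: "ideal_generated (fence a b) {a} = ideal_generated (fence a b) (fence_antichain a b p)"
        unfolding ideal_generated_top by blast
      have "{a} \<in> antichains (fence a b)" "fence_antichain a b p \<in> antichains (fence a b)"
        using p unfolding A.X_eq by blast+
      with eq have "{a} = fence_antichain a b p"
        by (rule inj_onD[OF inj])
      with p A.T_fresh show False by blast
    qed
    show "bij_betw (ideal_rowmotion (fence a b)) (order_ideals (fence a b)) (order_ideals (fence a b))"
      by (rule bij_betw_ideal_rowmotion[OF partial_order_fence finite_Field_fence])
    show "ideal_rowmotion (fence a b) (Field (fence a b)) = ideal_generated (fence a b) (fence_antichain a b (0, 0))"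
      by (simp only: A.f_T flip: ideal_generated_antichain_rowmotion ideal_generated_top)
    show "ideal_rowmotion (fence a b) (ideal_generated (fence a b) (fence_antichain a b (i, j))) =
        (if Suc i = a \<and> Suc j = b then Field (fence a b)
         else ideal_generated (fence a b) (fence_antichain a b (Suc i mod a, Suc j mod b)))"
      if "i < a" "j < b" for i j
      by (simp only: A.f_E[OF that] if_distrib[of "ideal_generated (fence a b)"] ideal_generated_top
          flip: ideal_generated_antichain_rowmotion)
  qed (rule pos)+
qed

end

section \<open>The totals of both statistics\<close>

lemma total_size_antichain_cycle:
  assumes "a > 0" "b > 0" "k < gcd a b"
  shows "real (total_size (torus_with_top.cycle a b (fence_antichain a b) {a} k)) =
    (2 * real a * real b - real a - real b) / real (gcd a b) + of_bool (k = 0)"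
proof -
  interpret torus_with_top a b "antichain_rowmotion (fence a b)" "antichains (fence a b)"
    "fence_antichain a b" "{a}"
    using assms by (intro antichain_torus)
  have pos_sum: "(\<Sum>i<n. of_bool (i > 0)) = n - 1" for n :: nat
    by (induction n) auto
  have "real (gcd a b) * real (lcm a b) = real a * real b"
    by (simp flip: of_nat_mult)
  then have "real (lcm a b) = real a * real b / real (gcd a b)"
    using pos by (simp add: field_simps)
  then have lcm_div: "real (lcm a b div a) = real b / real (gcd a b)"
    "real (lcm a b div b) = real a / real (gcd a b)"
    using pos by (simp_all add: real_of_nat_div)
  \<comment> \<open>A coordinate contributes 1 unless it is 0, so full periods give
    \<open>a - 1\<close> and \<open>b - 1\<close>; the antichain \<open>{a}\<close> gives the last
    summand.\<close>
  have "total_size (cycle k) =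
      lcm a b div a * (a - 1) + lcm a b div b * (b - 1) + of_bool (k = 0)"
    unfolding total_size_def
    using sum_cycle_additive[OF assms(3), where w = card and u = "\<lambda>i. of_bool (i > 0)"
        and v = "\<lambda>j. of_bool (j > 0)"] card_fence_antichain[OF assms(1,2)]
    by (simp add: pos_sum)
  then have "real (total_size (cycle k)) =
      real (lcm a b div a) * (real a - 1) + real (lcm a b div b) * (real b - 1) + of_bool (k = 0)"
    using pos by (simp add: of_nat_diff)
  also have "\<dots> = (2 * real a * real b - real a - real b) / real (gcd a b) + of_bool (k = 0)"
    unfolding lcm_div using pos by (simp add: field_simps)
  finally show ?thesis .
qed

text \<open>The coordinates average to \<open>(a - 1) / 2\<close> and \<open>(b - 1) / 2\<close>
  over the diagonal, which gives the main term; for \<open>k = 0\<close> the whole fence adds its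
  \<open>a + b - 1\<close> elements.\<close>

lemma total_size_ideal_cycle:
  assumes "a > 0" "b > 0" "k < gcd a b"
  shows "real (total_size (torus_with_top.cycle a b
      (\<lambda>p. ideal_generated (fence a b) (fence_antichain a b p)) (Field (fence a b)) k)) =
    real (lcm a b) * (real a + real b - 2) / 2 + of_bool (k = 0) * (real a + real b - 1)"
proof -
  interpret torus_with_top a b "ideal_rowmotion (fence a b)" "order_ideals (fence a b)"
    "\<lambda>p. ideal_generated (fence a b) (fence_antichain a b p)" "Field (fence a b)"
    using assms by (intro ideal_torus)
  have gauss: "2 * (\<Sum>i<n. i) = n * (n - 1)" for n :: nat
  proof (induction n)
    case (Suc n)
    then show ?case by (cases n) simp_all
  qed simp
  have card_E: "card (ideal_generated (fence a b) (fence_antichain a b (i, j))) = i + j"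
    if "i < a" "j < b" for i j
    using that pos by (simp add: ideal_generated_fence_antichain card_fence_ideal)
  have "total_size (cycle k) = lcm a b div a * (\<Sum>i<a. i) + lcm a b div b * (\<Sum>j<b. j) +
      of_bool (k = 0) * (a + b - 1)"
    unfolding total_size_def
    using sum_cycle_additive[OF assms(3), where w = card and u = "\<lambda>i. i" and v = "\<lambda>j. j"] card_E
    by (simp add: Field_fence_eq[OF pos])
  \<comment> \<open>Doubling makes \<open>gauss\<close> applicable without halving natural
    numbers.\<close>
  then have "2 * total_size (cycle k) =
      lcm a b div a * (2 * (\<Sum>i<a. i)) + lcm a b div b * (2 * (\<Sum>j<b. j)) +
      2 * (of_bool (k = 0) * (a + b - 1))"
    by (simp only: algebra_simps)
  also have "\<dots> = lcm a b * (a - 1) + lcm a b * (b - 1) + 2 * (of_bool (k = 0) * (a + b - 1))"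
    unfolding gauss by (simp flip: mult.assoc)
  finally have "real (2 * total_size (cycle k)) =
      real (lcm a b * (a - 1) + lcm a b * (b - 1) + 2 * (of_bool (k = 0) * (a + b - 1)))"
    by (rule arg_cong)
  then have "2 * real (total_size (cycle k)) = real (lcm a b) * (real a - 1) +
      real (lcm a b) * (real b - 1) + 2 * (of_bool (k = 0) * (real a + real b - 1))"
    using pos by (simp add: of_nat_diff del: of_nat_eq_iff)
  then show ?thesis
    by (simp add: field_simps)
qed

theorem theorem4p3:
  fixes a b l :: nat and m :: real
  assumes "a \<ge> 2" and "b \<ge> 2"
  defines "l \<equiv> lcm a b"
    and "m \<equiv> (2 * real a * real b - real a - real b) / real (gcd a b)"
  shows "(antichain_orbit (fence a b) {} \<in> antichain_orbits (fence a b) \<and>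
          card (antichain_orbit (fence a b) {}) = l + 1 \<and>
          (\<forall>\<O> \<in> antichain_orbits (fence a b).
             \<O> \<noteq> antichain_orbit (fence a b) {} \<longrightarrow> card \<O> = l))
       \<and> (ideal_orbit (fence a b) {} \<in> ideal_orbits (fence a b) \<and>
          card (ideal_orbit (fence a b) {}) = l + 1 \<and>
          (\<forall>\<O> \<in> ideal_orbits (fence a b).
             \<O> \<noteq> ideal_orbit (fence a b) {} \<longrightarrow> card \<O> = l))
       \<and> card (antichain_orbits (fence a b)) = gcd a b
       \<and> card (ideal_orbits (fence a b)) = gcd a b
       \<and> (\<forall>\<O> \<in> antichain_orbits (fence a b).
            (card \<O> = l \<longrightarrow> real (total_size \<O>) = m) \<and>
            (card \<O> = l + 1 \<longrightarrow> real (total_size \<O>) = m + 1))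
       \<and> (\<forall>\<O> \<in> ideal_orbits (fence a b).
            (card \<O> = l \<longrightarrow>
               real (total_size \<O>) = real l * (real a + real b - 2) / 2) \<and>
            (card \<O> = l + 1 \<longrightarrow>
               real (total_size \<O>) = (real l + 2) * (real a + real b - 2) / 2 + 1))"
proof -
  have pos: "a > 0" "b > 0" using assms by auto
  interpret A: torus_with_top a b "antichain_rowmotion (fence a b)" "antichains (fence a b)"
    "fence_antichain a b" "{a}"
    using pos by (rule antichain_torus)
  interpret I: torus_with_top a b "ideal_rowmotion (fence a b)" "order_ideals (fence a b)"
    "\<lambda>p. ideal_generated (fence a b) (fence_antichain a b p)" "Field (fence a b)"
    using pos by (rule ideal_torus)
  \<comment> \<open>The empty antichain generates the empty ideal, so \<open>origin\<close> concerns
    \<open>E (0, 0)\<close> in both instances.\<close>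
  have "fence_antichain a b (0, 0) = {}"
    by (simp add: fence_antichain_def)
  then have origin: "antichain_orbit (fence a b) {} = A.cycle 0"
    "ideal_orbit (fence a b) {} = I.cycle 0"
    using A.orb_origin I.orb_origin
    by (simp_all add: antichain_orbit_def ideal_orbit_def ideal_generated_def)
  have orbits: "antichain_orbits (fence a b) = A.cycle ` {..<gcd a b}"
    "ideal_orbits (fence a b) = I.cycle ` {..<gcd a b}"
    unfolding antichain_orbits_def ideal_orbits_def by (rule A.orbits_eq I.orbits_eq)+
  have g: "0 < gcd a b" using pos by simp
  have cards: "card (A.cycle k) = l + of_bool (k = 0)" "card (I.cycle k) = l + of_bool (k = 0)"
    if "k < gcd a b" for k
    using that by (simp_all add: A.card_cycle I.card_cycle l_def)
  have sizes: "real (total_size (A.cycle k)) = m + of_bool (k = 0)"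
    "real (total_size (I.cycle k)) =
      real l * (real a + real b - 2) / 2 + of_bool (k = 0) * (real a + real b - 1)"
    if "k < gcd a b" for k
    using total_size_antichain_cycle[OF pos that] total_size_ideal_cycle[OF pos that]
    by (simp_all only: m_def l_def)
  \<comment> \<open>Rewrites the exceptional total as the ordinary one plus the size of the whole
    fence, the form given by \<open>sizes\<close>.\<close>
  have split_big: "(real l + 2) * (real a + real b - 2) / 2 + 1 =
      real l * (real a + real b - 2) / 2 + (real a + real b - 1)"
    by (simp add: field_simps)
  show ?thesis
    unfolding origin split_big
  proof (intro conjI ballI impI)
    show "A.cycle 0 \<in> antichain_orbits (fence a b)" "I.cycle 0 \<in> ideal_orbits (fence a b)"
      using g by (auto simp: orbits)
    show "card (A.cycle 0) = l + 1" "card (I.cycle 0) = l + 1"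
      using cards[OF g] by simp_all
    show "card (antichain_orbits (fence a b)) = gcd a b" "card (ideal_orbits (fence a b)) = gcd a b"
      using A.card_orbits I.card_orbits by (simp_all add: antichain_orbits_def ideal_orbits_def)
  next
    fix \<O> assume "\<O> \<in> antichain_orbits (fence a b)"
    then obtain k where k: "k < gcd a b" "\<O> = A.cycle k" by (auto simp: orbits)
    show "card \<O> = l" if "\<O> \<noteq> A.cycle 0"
      using that k cards(1)[of k] by (cases "k = 0") simp_all
    \<comment> \<open>The cardinality tells whether \<open>k = 0\<close>, so each hypothesis on it
      selects one of the two values in \<open>sizes\<close>.\<close>
    show "real (total_size \<O>) = m" if "card \<O> = l"
      using that k cards(1)[of k] sizes(1)[of k] by (cases "k = 0") simp_all
    show "real (total_size \<O>) = m + 1" if "card \<O> = l + 1"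
      using that k cards(1)[of k] sizes(1)[of k] by (cases "k = 0") simp_all
  next
    fix \<O> assume "\<O> \<in> ideal_orbits (fence a b)"
    then obtain k where k: "k < gcd a b" "\<O> = I.cycle k" by (auto simp: orbits)
    show "card \<O> = l" if "\<O> \<noteq> I.cycle 0"
      using that k cards(2)[of k] by (cases "k = 0") simp_all
    show "real (total_size \<O>) = real l * (real a + real b - 2) / 2" if "card \<O> = l"
      using that k cards(2)[of k] sizes(2)[of k] by (cases "k = 0") simp_all
    show "real (total_size \<O>) = real l * (real a + real b - 2) / 2 + (real a + real b - 1)"
      if "card \<O> = l + 1"
      using that k cards(2)[of k] sizes(2)[of k] by (cases "k = 0") simp_all
  qed
qed

end
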